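(* Let $\alpha<\beta$ be real numbers and $J=[\alpha,\beta]$. Let $u(t)$, $b(t)$, $k(t,s)$ and $h(t,s,\tau)$ be nonnegative continuous functions for $\alpha\le\tau\le s\le t\le\beta$, and let $p>1$ be a constant. Suppose $a(t)\ge 0$ is nondecreasing in $J$ and $$u(t)\le a(t)+\int_\alpha^t b(s)u^p(s)\,ds+\int_\alpha^t\int_\alpha^s k(s,\tau)u^p(\tau)\,d\tau\,ds+\int_\alpha^t\int_\alpha^s\int_\alpha^\tau h(s,\tau,\sigma)u^p(\sigma)\,d\sigma\,d\tau\,ds$$ for all $t\in[\alpha,\beta]$. Then $$u(t)\le a(t)\left[1-(p-1)\int_\alpha^t B(s)a^{p-1}(s)\,ds\right]^{\frac{1}{1-p}},\qquad t\in[\alpha,\beta_p),$$ where $$B(t)=b(t)+\int_\alpha^t k(t,s)\,ds+\int_\alpha^t\int_\alpha^s h(t,s,\tau)\,d\tau\,ds$$ and $$\beta_p=\sup\left\{t\in J:\ (p-1)\int_\alpha^t B(s)a^{p-1}(s)\,ds<1\right\}.$$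
   Context: All functions are real-valued. The functions $u,b$ are defined on $[\alpha,\beta]$, $k$ on $\{(t,s):\alpha\le s\le t\le\beta\}$, and $h$ on $\{(t,s,\tau):\alpha\le\tau\le s\le t\le\beta\}$. The notation $u^p(s)$ means $(u(s))^p$. *)

theory Defs
  imports "HOL-Analysis.Analysis"
begin

definition B_fun ::
  "real \<Rightarrow> (real \<Rightarrow> real) \<Rightarrow> (real \<Rightarrow> real \<Rightarrow> real) \<Rightarrow> (real \<Rightarrow> real \<Rightarrow> real \<Rightarrow> real) \<Rightarrow> real \<Rightarrow> real"
  where
  "B_fun \<alpha> b k h t =
     b t + integral {\<alpha>..t} (\<lambda>s. k t s)
         + integral {\<alpha>..t} (\<lambda>s. integral {\<alpha>..s} (\<lambda>\<tau>. h t s \<tau>))"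

text \<open>
  Here \<open>0 powr (p - 1) = 0\<close>, which is the intended value since \<open>p > 1\<close>.  The set
  below contains \<open>\<alpha>\<close> and is bounded above by \<open>\<beta>\<close>, so \<open>Sup\<close> is a genuine supremum.
\<close>

definition beta_p ::
  "real \<Rightarrow> real \<Rightarrow> real \<Rightarrow> (real \<Rightarrow> real) \<Rightarrow> (real \<Rightarrow> real) \<Rightarrow> (real \<Rightarrow> real \<Rightarrow> real)
    \<Rightarrow> (real \<Rightarrow> real \<Rightarrow> real \<Rightarrow> real) \<Rightarrow> real"
  where
  "beta_p \<alpha> \<beta> p a b k h =
     Sup {t \<in> {\<alpha>..\<beta>}. (p - 1) * integral {\<alpha>..t} (\<lambda>s. B_fun \<alpha> b k h s * a s powr (p - 1)) < 1}"

end

theory Submission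
  imports Defs
begin

text \<open>
  Let \<open>F\<close> be the integrand on the right-hand side once the three integrals are merged, so that the
  hypothesis reads \<open>u t \<le> a t + \<integral>\<^sub>\<alpha>\<^sup>t F\<close>. The integral operators in \<open>F\<close> look only into the past;
  hence if \<open>u \<le> M\<close> on \<open>[\<alpha>, t]\<close>, then \<open>F t \<le> B t * M\<^sup>p\<close> (\<open>B_fun_weighted_le\<close>). This reduces the
  triple integral to a scalar problem.

  Suppose first that \<open>a > 0\<close>, and put \<open>z t = 1 + \<integral>\<^sub>\<alpha>\<^sup>t F / a\<close>. As \<open>a\<close> is nondecreasing,
  \<open>u t / a t \<le> 1 + \<integral>\<^sub>\<alpha>\<^sup>t F / a t \<le> z t\<close>. The function \<open>a * z\<close> is nondecreasing as well, so \<open>u\<close> is at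
  most \<open>a t * z t\<close> on \<open>[\<alpha>, t]\<close>, and the bound on \<open>F\<close> gives \<open>F / a \<le> w * z\<^sup>p\<close> with
  \<open>w = B * a powr (p - 1)\<close>. Formally \<open>z' \<le> w * z\<^sup>p\<close>, and integrating the derivative of
  \<open>z powr (1 - p)\<close> gives \<open>1 - z t powr (1 - p) \<le> (p - 1) * \<integral>\<^sub>\<alpha>\<^sup>t w\<close>, which is the claimed estimate
  for \<open>z\<close> and hence for \<open>u \<le> a * z\<close>.

  Since \<open>a\<close> may jump, \<open>z\<close> need not be differentiable. The lemma \<open>bihari_increments\<close> therefore
  integrates the differential inequality by comparing increments over short intervals, which
  uses only the continuity of \<open>z\<close>. Finally a majorant with zeros is replaced by \<open>a + 1 / (n + 1)\<close>,
  and dominated convergence yields the estimate for \<open>a\<close> in the limit.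
\<close>

section \<open>Integrals whose upper limit depends on a parameter\<close>

text \<open>
  The affine change of variables \<open>\<sigma> = \<alpha> + (c - \<alpha>) r\<close> makes the interval of integration
  constant, and it survives the degenerate case \<open>c = \<alpha>\<close>.
\<close>

lemma integral_rescale_to_unit_interval:
  fixes f :: "real \<Rightarrow> real"
  assumes "\<alpha> \<le> c" and "continuous_on {\<alpha>..c} f"
  shows "integral {\<alpha>..c} f = integral {0..1} (\<lambda>r. (c - \<alpha>) * f (\<alpha> + (c - \<alpha>) * r))"
proof -
  let ?g = "\<lambda>r. \<alpha> + (c - \<alpha>) * r"
  have "((\<lambda>r. (c - \<alpha>) *\<^sub>R f (?g r)) has_integral (integral {?g 0..?g 1} f)) {0..1}"
  proof (rule has_integral_substitution[where c = \<alpha> and d = c])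
    have "?g r \<le> c" if "r \<in> {0..1}" for r
      using mult_left_le[of r "c - \<alpha>"] that assms(1) by auto
    then show "?g ` {0..1} \<subseteq> {\<alpha>..c}"
      using assms(1) by auto
  qed (use assms in \<open>auto intro!: derivative_eq_intros\<close>)
  then show ?thesis
    by (intro integral_unique[symmetric]) simp
qed

text \<open>
  The space of parameters is arbitrary because the lemma is needed twice for a kernel of three
  variables: with the pair \<open>(t, s)\<close> as parameter for the inner integral, then with \<open>t\<close> alone.
\<close>

lemma continuous_on_integral_variable_upper_limit:
  fixes f :: "'a::topological_space \<Rightarrow> real \<Rightarrow> real" and e :: "'a \<Rightarrow> real"
  assumes e: "continuous_on S e" "\<And>x. x \<in> S \<Longrightarrow> \<alpha> \<le> e x"
    and f: "continuous_on {(x, r). x \<in> S \<and> \<alpha> \<le> r \<and> r \<le> e x} (\<lambda>(x, r). f x r)"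
  shows "continuous_on S (\<lambda>x. integral {\<alpha>..e x} (f x))"
proof -
  let ?g = "\<lambda>x r. \<alpha> + (e x - \<alpha>) * r"
  have g: "\<alpha> \<le> ?g x r \<and> ?g x r \<le> e x" if "x \<in> S" "r \<in> {0..1}" for x r
    using mult_left_le[of r "e x - \<alpha>"] that e(2)[OF that(1)] by auto
  have ec: "continuous_on (S \<times> {0..1}) (\<lambda>q. e (fst q))"
    by (rule continuous_on_compose2[OF e(1)]) (auto intro!: continuous_intros)
  have "continuous_on (S \<times> {0..1}) (\<lambda>q. (case (fst q, ?g (fst q) (snd q)) of (x, r) \<Rightarrow> f x r))"
  proof (rule continuous_on_compose2[OF f])
    show "continuous_on (S \<times> {0..1}) (\<lambda>q. (fst q, ?g (fst q) (snd q)))"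
      by (intro continuous_intros ec)
  qed (use g in auto)
  then have "continuous_on (S \<times> cbox 0 1) (\<lambda>(x, r). (e x - \<alpha>) * f x (?g x r))"
    using ec by (auto simp: case_prod_unfold intro!: continuous_intros)
  then have "continuous_on S (\<lambda>x. integral (cbox 0 1) (\<lambda>r. (e x - \<alpha>) * f x (?g x r)))"
    by (rule integral_continuous_on_param)
  moreover have "integral {\<alpha>..e x} (f x) = integral (cbox 0 1) (\<lambda>r. (e x - \<alpha>) * f x (?g x r))"
    if x: "x \<in> S" for x
  proof -
    have "continuous_on {\<alpha>..e x} (\<lambda>r. case (x, r) of (x, r) \<Rightarrow> f x r)"
      by (rule continuous_on_compose2[OF f]) (use x in \<open>auto intro!: continuous_intros\<close>)
    then show ?thesis
      using integral_rescale_to_unit_interval[OF e(2)[OF x], of "f x"] by simp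
  qed
  ultimately show ?thesis
    by (simp cong: continuous_on_cong)
qed

section \<open>Nonnegative continuous kernels\<close>

locale volterra_kernels =
  fixes \<alpha> \<beta> :: real and b :: "real \<Rightarrow> real" and k :: "real \<Rightarrow> real \<Rightarrow> real"
    and h :: "real \<Rightarrow> real \<Rightarrow> real \<Rightarrow> real"
  assumes b_cont: "continuous_on {\<alpha>..\<beta>} b"
    and k_cont: "continuous_on {(t, s). \<alpha> \<le> s \<and> s \<le> t \<and> t \<le> \<beta>} (\<lambda>(t, s). k t s)"
    and h_cont: "continuous_on {(t, s, \<tau>). \<alpha> \<le> \<tau> \<and> \<tau> \<le> s \<and> s \<le> t \<and> t \<le> \<beta>}
                   (\<lambda>(t, s, \<tau>). h t s \<tau>)"
    and b_nonneg: "\<And>t. t \<in> {\<alpha>..\<beta>} \<Longrightarrow> 0 \<le> b t"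
    and k_nonneg: "\<And>t s. \<alpha> \<le> s \<Longrightarrow> s \<le> t \<Longrightarrow> t \<le> \<beta> \<Longrightarrow> 0 \<le> k t s"
    and h_nonneg: "\<And>t s \<tau>. \<alpha> \<le> \<tau> \<Longrightarrow> \<tau> \<le> s \<Longrightarrow> s \<le> t \<Longrightarrow> t \<le> \<beta> \<Longrightarrow> 0 \<le> h t s \<tau>"
begin

lemma k_slice_integrable:
  assumes "t \<le> \<beta>"
  shows "(\<lambda>s. k t s) integrable_on {\<alpha>..t}"
proof -
  have "continuous_on {\<alpha>..t} (\<lambda>s. case (t, s) of (t, s) \<Rightarrow> k t s)"
    by (rule continuous_on_compose2[OF k_cont]) (use assms in \<open>auto intro!: continuous_intros\<close>)
  then show ?thesis
    using integrable_continuous_real by simp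
qed

lemma h_slice_integrable:
  assumes "s \<le> t" "t \<le> \<beta>"
  shows "(\<lambda>\<tau>. h t s \<tau>) integrable_on {\<alpha>..s}"
proof -
  have "continuous_on {\<alpha>..s} (\<lambda>\<tau>. case (t, s, \<tau>) of (t, s, \<tau>) \<Rightarrow> h t s \<tau>)"
    by (rule continuous_on_compose2[OF h_cont]) (use assms in \<open>auto intro!: continuous_intros\<close>)
  then show ?thesis
    using integrable_continuous_real by simp
qed

lemma inner_h_integral_continuous:
  "continuous_on {(t, s). \<alpha> \<le> s \<and> s \<le> t \<and> t \<le> \<beta>} (\<lambda>(t, s). integral {\<alpha>..s} (h t s))"
proof -
  let ?S = "{(t, s). \<alpha> \<le> s \<and> s \<le> t \<and> t \<le> \<beta>}"
  have "continuous_on {(x, r). x \<in> ?S \<and> \<alpha> \<le> r \<and> r \<le> snd x}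
          (\<lambda>q. case (fst (fst q), snd (fst q), snd q) of (t, s, \<tau>) \<Rightarrow> h t s \<tau>)"
    by (rule continuous_on_compose2[OF h_cont]) (auto intro!: continuous_intros)
  then have "continuous_on {(x, r). x \<in> ?S \<and> \<alpha> \<le> r \<and> r \<le> snd x}
          (\<lambda>(x, r). (\<lambda>x. h (fst x) (snd x)) x r)"
    by (simp add: case_prod_unfold)
  then have "continuous_on ?S (\<lambda>x. integral {\<alpha>..snd x} ((\<lambda>x. h (fst x) (snd x)) x))"
    by (intro continuous_on_integral_variable_upper_limit) (auto intro!: continuous_intros)
  then show ?thesis
    by (simp add: case_prod_unfold)
qed

lemma inner_h_integral_slice_integrable:
  assumes "t \<le> \<beta>"
  shows "(\<lambda>s. integral {\<alpha>..s} (h t s)) integrable_on {\<alpha>..t}"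
proof -
  have "continuous_on {\<alpha>..t} (\<lambda>s. case (t, s) of (t, s) \<Rightarrow> integral {\<alpha>..s} (h t s))"
    by (rule continuous_on_compose2[OF inner_h_integral_continuous])
      (use assms in \<open>auto intro!: continuous_intros\<close>)
  then show ?thesis
    using integrable_continuous_real by simp
qed

lemma k_integral_continuous: "continuous_on {\<alpha>..\<beta>} (\<lambda>t. integral {\<alpha>..t} (k t))"
  by (rule continuous_on_integral_variable_upper_limit)
    (auto intro!: continuous_intros continuous_on_subset[OF k_cont])

lemma h_integral_continuous:
  "continuous_on {\<alpha>..\<beta>} (\<lambda>t. integral {\<alpha>..t} (\<lambda>s. integral {\<alpha>..s} (h t s)))"
  by (rule continuous_on_integral_variable_upper_limit)
    (auto intro!: continuous_intros continuous_on_subset[OF inner_h_integral_continuous])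

lemma B_fun_continuous: "continuous_on {\<alpha>..\<beta>} (B_fun \<alpha> b k h)"
  unfolding B_fun_def
  by (intro continuous_intros b_cont k_integral_continuous h_integral_continuous)

lemma B_fun_nonneg:
  assumes "t \<in> {\<alpha>..\<beta>}"
  shows "0 \<le> B_fun \<alpha> b k h t"
  unfolding B_fun_def using assms
  by (intro add_nonneg_nonneg b_nonneg integral_nonneg k_slice_integrable h_slice_integrable
      inner_h_integral_slice_integrable k_nonneg h_nonneg) auto

lemma integral_B_fun:
  assumes "t \<le> \<beta>"
  shows "integral {\<alpha>..t} (B_fun \<alpha> b k h) =
      integral {\<alpha>..t} b + integral {\<alpha>..t} (\<lambda>s. integral {\<alpha>..s} (k s))
      + integral {\<alpha>..t} (\<lambda>s. integral {\<alpha>..s} (\<lambda>\<tau>. integral {\<alpha>..\<tau>} (h s \<tau>)))"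
proof -
  have sub: "{\<alpha>..t} \<subseteq> {\<alpha>..\<beta>}"
    using assms by auto
  note int = continuous_on_subset[OF b_cont sub] continuous_on_subset[OF k_integral_continuous sub]
    continuous_on_subset[OF h_integral_continuous sub]
  show ?thesis
    unfolding B_fun_def[abs_def]
    by (subst integral_add integral_add | intro integrable_add integrable_continuous_real int refl)+
qed

text \<open>
  With \<open>g = u\<^sup>p\<close>, the right-hand side of the integral inequality is \<open>a t\<close> plus the
  primitive of the function \<open>B_fun\<close> of the kernels weighted by \<open>g\<close>.
\<close>

lemma volterra_kernels_weighted:
  assumes g: "continuous_on {\<alpha>..\<beta>} g" "\<And>t. t \<in> {\<alpha>..\<beta>} \<Longrightarrow> 0 \<le> g t"
  shows "volterra_kernels \<alpha> \<beta> (\<lambda>t. b t * g t) (\<lambda>t s. k t s * g s) (\<lambda>t s \<tau>. h t s \<tau> * g \<tau>)"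
proof
  show "continuous_on {\<alpha>..\<beta>} (\<lambda>t. b t * g t)"
    by (intro continuous_intros b_cont g)
  have "continuous_on {(t, s). \<alpha> \<le> s \<and> s \<le> t \<and> t \<le> \<beta>} (\<lambda>q. g (snd q))"
    by (rule continuous_on_compose2[OF g(1)]) (auto intro!: continuous_intros)
  then show "continuous_on {(t, s). \<alpha> \<le> s \<and> s \<le> t \<and> t \<le> \<beta>} (\<lambda>(t, s). k t s * g s)"
    using k_cont by (auto simp: case_prod_unfold intro!: continuous_intros)
  have "continuous_on {(t, s, \<tau>). \<alpha> \<le> \<tau> \<and> \<tau> \<le> s \<and> s \<le> t \<and> t \<le> \<beta>} (\<lambda>q. g (snd (snd q)))"
    by (rule continuous_on_compose2[OF g(1)]) (auto intro!: continuous_intros)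
  then show "continuous_on {(t, s, \<tau>). \<alpha> \<le> \<tau> \<and> \<tau> \<le> s \<and> s \<le> t \<and> t \<le> \<beta>}
          (\<lambda>(t, s, \<tau>). h t s \<tau> * g \<tau>)"
    using h_cont by (auto simp: case_prod_unfold intro!: continuous_intros)
qed (auto intro!: mult_nonneg_nonneg b_nonneg k_nonneg h_nonneg g)

text \<open>
  The value of the weighted \<open>B_fun\<close> at \<open>t\<close> involves \<open>g\<close> only on \<open>[\<alpha>, t]\<close>, and the kernels are
  nonnegative, so \<open>g\<close> may be replaced by its bound \<open>M\<close>, which then factors out.
\<close>

lemma B_fun_weighted_le:
  assumes g: "continuous_on {\<alpha>..\<beta>} g" "\<And>t. t \<in> {\<alpha>..\<beta>} \<Longrightarrow> 0 \<le> g t"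
    and t: "t \<in> {\<alpha>..\<beta>}" and M: "\<And>s. s \<in> {\<alpha>..t} \<Longrightarrow> g s \<le> M"
  shows "B_fun \<alpha> (\<lambda>t. b t * g t) (\<lambda>t s. k t s * g s) (\<lambda>t s \<tau>. h t s \<tau> * g \<tau>) t
      \<le> B_fun \<alpha> b k h t * M"
proof -
  interpret G: volterra_kernels \<alpha> \<beta> "\<lambda>t. b t * g t" "\<lambda>t s. k t s * g s" "\<lambda>t s \<tau>. h t s \<tau> * g \<tau>"
    by (rule volterra_kernels_weighted[OF g])
  have "b t * g t \<le> b t * M"
    using M[of t] b_nonneg[OF t] t by (intro mult_left_mono) auto
  moreover have "integral {\<alpha>..t} (\<lambda>s. k t s * g s) \<le> integral {\<alpha>..t} (\<lambda>s. k t s * M)"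
    using t M k_nonneg
    by (intro integral_le G.k_slice_integrable integrable_on_mult_left k_slice_integrable
        mult_left_mono) auto
  moreover have "integral {\<alpha>..t} (\<lambda>s. integral {\<alpha>..s} (\<lambda>\<tau>. h t s \<tau> * g \<tau>))
      \<le> integral {\<alpha>..t} (\<lambda>s. integral {\<alpha>..s} (h t s) * M)"
  proof (rule integral_le)
    fix s assume s: "s \<in> {\<alpha>..t}"
    have "integral {\<alpha>..s} (\<lambda>\<tau>. h t s \<tau> * g \<tau>) \<le> integral {\<alpha>..s} (\<lambda>\<tau>. h t s \<tau> * M)"
      using t s M h_nonneg
      by (intro integral_le G.h_slice_integrable integrable_on_mult_left h_slice_integrable
          mult_left_mono) auto
    then show "integral {\<alpha>..s} (\<lambda>\<tau>. h t s \<tau> * g \<tau>) \<le> integral {\<alpha>..s} (h t s) * M"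
      by simp
  qed (use t in \<open>auto intro!: G.inner_h_integral_slice_integrable integrable_on_mult_left
        inner_h_integral_slice_integrable\<close>)
  ultimately show ?thesis
    unfolding B_fun_def by (simp add: distrib_right)
qed

end

section \<open>A Bihari inequality in terms of increments\<close>

lemma powr_one_minus_diff_le:
  fixes x y p :: real
  assumes "0 < x" "x \<le> y" "1 < p"
  shows "x powr (1 - p) - y powr (1 - p) \<le> (p - 1) * (y - x) / x powr p"
proof (cases "x = y")
  case False
  then have "x < y" using assms by simp
  have "\<exists>\<xi>>x. \<xi> < y \<and> y powr (1 - p) - x powr (1 - p) = (y - x) * ((1 - p) * \<xi> powr (1 - p - 1))"
    using \<open>x < y\<close> \<open>0 < x\<close> by (intro MVT2 has_real_derivative_powr) auto
  then obtain \<xi> where \<xi>: "x < \<xi>" "y powr (1 - p) - x powr (1 - p) = (y - x) * ((1 - p) * \<xi> powr (- p))"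
    by auto
  have "x powr (1 - p) - y powr (1 - p) = (p - 1) * (y - x) * \<xi> powr (- p)"
    using \<xi>(2) by (simp add: algebra_simps)
  also have "\<dots> \<le> (p - 1) * (y - x) * x powr (- p)"
    using assms \<xi> by (intro mult_left_mono powr_mono2') auto
  finally show ?thesis
    by (simp add: powr_minus_divide)
qed simp

lemma le_of_le_on_short_steps:
  fixes D :: "real \<Rightarrow> real"
  assumes "\<alpha> \<le> T" "0 < \<delta>"
    and step: "\<And>s t. \<alpha> \<le> s \<Longrightarrow> s \<le> t \<Longrightarrow> t \<le> T \<Longrightarrow> t - s \<le> \<delta> \<Longrightarrow> D s \<le> D t"
  shows "D \<alpha> \<le> D T"
proof -
  have "\<alpha> \<le> t \<longrightarrow> t \<le> T \<longrightarrow> t - \<alpha> \<le> real n * \<delta> \<longrightarrow> D \<alpha> \<le> D t" for n t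
  proof (induction n arbitrary: t)
    case (Suc n)
    show ?case
    proof (intro impI)
      assume t: "\<alpha> \<le> t" "t \<le> T" "t - \<alpha> \<le> real (Suc n) * \<delta>"
      define s where "s = max \<alpha> (t - \<delta>)"
      have "D \<alpha> \<le> D s"
        using Suc.IH[of s] t \<open>0 < \<delta>\<close> by (auto simp: s_def max_def algebra_simps)
      also have "D s \<le> D t"
        using t \<open>0 < \<delta>\<close> by (intro step) (auto simp: s_def)
      finally show "D \<alpha> \<le> D t" .
    qed
  qed auto
  moreover obtain n where "T - \<alpha> \<le> real n * \<delta>"
    using reals_Archimedean3[OF \<open>0 < \<delta>\<close>] less_imp_le by blast
  ultimately show ?thesis
    using \<open>\<alpha> \<le> T\<close> by blast
qed

text \<open>
  If \<open>z\<close> and \<open>\<phi>\<close> were differentiable, the hypothesis on increments would be \<open>z' \<le> z\<^sup>p * \<phi>'\<close>, and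
  integrating \<open>(z powr (1 - p))' = - (p - 1) * z' / z\<^sup>p \<ge> - (p - 1) * \<phi>'\<close> would give the conclusion.
  Without derivatives, the mean value theorem bounds the decrease of \<open>z powr (1 - p)\<close> from \<open>s\<close> to
  \<open>t\<close> by \<open>p - 1\<close> times \<open>(z t / z s)\<^sup>p * (\<phi> t - \<phi> s)\<close>. On short steps the quotient costs at most
  a factor \<open>c > 1\<close>, so \<open>z powr (1 - p) + (p - 1) * c * \<phi>\<close> is nondecreasing; then \<open>c\<close> tends to \<open>1\<close>.
\<close>

lemma bihari_increments:
  fixes z \<phi> :: "real \<Rightarrow> real" and p :: real
  assumes "1 < p" "\<alpha> \<le> T"
    and cont: "continuous_on {\<alpha>..T} z"
    and pos: "\<And>t. t \<in> {\<alpha>..T} \<Longrightarrow> 0 < z t"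
    and mono: "\<And>s t. \<alpha> \<le> s \<Longrightarrow> s \<le> t \<Longrightarrow> t \<le> T \<Longrightarrow> z s \<le> z t"
    and incr: "\<And>s t. \<alpha> \<le> s \<Longrightarrow> s \<le> t \<Longrightarrow> t \<le> T \<Longrightarrow> z t - z s \<le> z t powr p * (\<phi> t - \<phi> s)"
  shows "z \<alpha> powr (1 - p) - z T powr (1 - p) \<le> (p - 1) * (\<phi> T - \<phi> \<alpha>)"
proof -
  have \<phi>_mono: "\<phi> s \<le> \<phi> t" if "\<alpha> \<le> s" "s \<le> t" "t \<le> T" for s t
  proof -
    have "0 \<le> z t powr p * (\<phi> t - \<phi> s)"
      using incr[OF that] mono[OF that] by linarith
    moreover have "0 < z t powr p"
      using pos[of t] that by simp
    ultimately show ?thesis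
      by (simp add: zero_le_mult_iff)
  qed
  have main: "z \<alpha> powr (1 - p) - z T powr (1 - p) \<le> (p - 1) * c * (\<phi> T - \<phi> \<alpha>)" if c: "1 < c" for c
  proof -
    \<comment> \<open>Uniform continuity of \<open>ln z\<close> keeps the quotient of \<open>z\<^sup>p\<close> at close points below \<open>c\<close>.\<close>
    have "uniformly_continuous_on {\<alpha>..T} (\<lambda>t. p * ln (z t))"
      using cont pos by (intro compact_uniformly_continuous continuous_intros) force+
    then obtain d where d: "0 < d" "\<And>s t. s \<in> {\<alpha>..T} \<Longrightarrow> t \<in> {\<alpha>..T} \<Longrightarrow> dist t s < d
        \<Longrightarrow> dist (p * ln (z t)) (p * ln (z s)) < ln c"
      using c unfolding uniformly_continuous_on_def by (metis ln_gt_zero)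
    have "z \<alpha> powr (1 - p) + (p - 1) * c * \<phi> \<alpha> \<le> z T powr (1 - p) + (p - 1) * c * \<phi> T"
    proof (rule le_of_le_on_short_steps[where \<delta> = "d / 2"
          and D = "\<lambda>t. z t powr (1 - p) + (p - 1) * c * \<phi> t"])
      fix s t assume st: "\<alpha> \<le> s" "s \<le> t" "t \<le> T" "t - s \<le> d / 2"
      have zs: "0 < z s" and zt: "0 < z t"
        using pos st by auto
      have "p * ln (z t) \<le> ln c + p * ln (z s)"
        using d(2)[of s t] st d(1) by (simp add: dist_real_def)
      then have "exp (p * ln (z t)) \<le> exp (ln c + p * ln (z s))"
        by simp
      then have quot: "z t powr p \<le> c * z s powr p"
        using zs zt c by (simp add: powr_def exp_add)
      have "z s powr (1 - p) - z t powr (1 - p) \<le> (p - 1) * (z t - z s) / z s powr p"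
        using powr_one_minus_diff_le[OF zs mono[OF st(1-3)] \<open>1 < p\<close>] .
      also have "\<dots> \<le> (p - 1) * (c * z s powr p * (\<phi> t - \<phi> s)) / z s powr p"
      proof (intro divide_right_mono mult_left_mono)
        have "z t powr p * (\<phi> t - \<phi> s) \<le> c * z s powr p * (\<phi> t - \<phi> s)"
          using quot \<phi>_mono[OF st(1-3)] by (intro mult_right_mono) auto
        then show "z t - z s \<le> c * z s powr p * (\<phi> t - \<phi> s)"
          using incr[OF st(1-3)] by linarith
      qed (use \<open>1 < p\<close> in auto)
      also have "\<dots> = (p - 1) * c * (\<phi> t - \<phi> s)"
        using zs by simp
      finally show "z s powr (1 - p) + (p - 1) * c * \<phi> s \<le> z t powr (1 - p) + (p - 1) * c * \<phi> t"
        by (simp add: algebra_simps)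
    qed (use \<open>\<alpha> \<le> T\<close> d(1) in auto)
    then show ?thesis
      by (simp add: algebra_simps)
  qed
  \<comment> \<open>The limit \<open>c \<rightarrow> 1\<close>, with \<open>c = 1 / r\<close>.\<close>
  show ?thesis
  proof (rule field_le_mult_one_interval)
    fix r :: real assume "0 < r" "r < 1"
    then have "z \<alpha> powr (1 - p) - z T powr (1 - p) \<le> (p - 1) * (1 / r) * (\<phi> T - \<phi> \<alpha>)"
      by (intro main) auto
    then show "r * (z \<alpha> powr (1 - p) - z T powr (1 - p)) \<le> (p - 1) * (\<phi> T - \<phi> \<alpha>)"
      using \<open>0 < r\<close> by (simp add: field_simps)
  qed
qed

section \<open>The estimate for a positive majorant\<close>

text \<open>
  The majorant \<open>a\<close> is only monotone, so the products with powers of \<open>a\<close> need not be continuous.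
  Their integrability is a by-product of the second mean value theorem.
\<close>

lemma integrable_on_mult_mono_on:
  fixes f g :: "real \<Rightarrow> real"
  assumes f: "f integrable_on {c..d}" and g: "mono_on {c..d} g"
  shows "(\<lambda>x. f x * g x) integrable_on {c..d}"
proof (cases "c \<le> d")
  case True
  have "g x \<le> g y" if "c \<le> x" "x \<le> y" "y \<le> d" for x y
    using that by (intro mono_onD[OF g]) auto
  then have "(\<lambda>x. g x * f x) integrable_on {c..d}"
    by (rule second_mean_value_theorem_full[OF f True]) (auto intro: has_integral_integrable)
  then show ?thesis
    by (simp add: mult.commute)
qed (simp add: integrable_on_empty)

context volterra_kernels
begin

text \<open>
  The comparison function is \<open>z t = 1 + \<integral>\<^sub>\<alpha>\<^sup>t F / a\<close> rather than \<open>1 + (\<integral>\<^sub>\<alpha>\<^sup>t F) / a t\<close>: the former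
  is continuous even where \<open>a\<close> jumps, and its increments are integrals of \<open>F / a \<le> w * z\<^sup>p\<close>, as
  \<open>bihari_increments\<close> requires.
\<close>

lemma bound_of_positive_majorant:
  fixes u a :: "real \<Rightarrow> real"
  assumes "1 < p" and T: "T \<in> {\<alpha>..\<beta>}"
    and u_cont: "continuous_on {\<alpha>..\<beta>} u" and u_nonneg: "\<And>t. t \<in> {\<alpha>..\<beta>} \<Longrightarrow> 0 \<le> u t"
    and a_pos: "\<And>t. t \<in> {\<alpha>..\<beta>} \<Longrightarrow> 0 < a t" and a_mono: "mono_on {\<alpha>..\<beta>} a"
    and ineq: "\<And>t. t \<in> {\<alpha>..\<beta>} \<Longrightarrow> u t \<le> a t + integral {\<alpha>..t}
        (B_fun \<alpha> (\<lambda>t. b t * u t powr p) (\<lambda>t s. k t s * u s powr p) (\<lambda>t s \<tau>. h t s \<tau> * u \<tau> powr p))"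
    and less1: "(p - 1) * integral {\<alpha>..T} (\<lambda>s. B_fun \<alpha> b k h s * a s powr (p - 1)) < 1"
  shows "u T \<le> a T * (1 - (p - 1) * integral {\<alpha>..T} (\<lambda>s. B_fun \<alpha> b k h s * a s powr (p - 1)))
      powr (1 / (1 - p))"
proof -
  have g: "continuous_on {\<alpha>..\<beta>} (\<lambda>t. u t powr p)" "\<And>t. t \<in> {\<alpha>..\<beta>} \<Longrightarrow> 0 \<le> u t powr p"
    using u_cont u_nonneg \<open>1 < p\<close> by (auto intro!: continuous_on_powr')
  interpret U: volterra_kernels \<alpha> \<beta> "\<lambda>t. b t * u t powr p" "\<lambda>t s. k t s * u s powr p"
      "\<lambda>t s \<tau>. h t s \<tau> * u \<tau> powr p"
    by (rule volterra_kernels_weighted[OF g])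
  define F where "F = B_fun \<alpha> (\<lambda>t. b t * u t powr p) (\<lambda>t s. k t s * u s powr p)
      (\<lambda>t s \<tau>. h t s \<tau> * u \<tau> powr p)"
  define z where "z = (\<lambda>t. 1 + integral {\<alpha>..t} (\<lambda>s. F s / a s))"
  define w where "w = (\<lambda>s. B_fun \<alpha> b k h s * a s powr (p - 1))"
  define \<phi> where "\<phi> = (\<lambda>t. integral {\<alpha>..t} w)"
  have F_nonneg: "0 \<le> F t" if "t \<in> {\<alpha>..\<beta>}" for t
    using U.B_fun_nonneg[OF that] by (simp add: F_def)
  have a_le: "a s \<le> a t" if "\<alpha> \<le> s" "s \<le> t" "t \<le> \<beta>" for s t
    using that by (intro mono_onD[OF a_mono]) auto
  have F_int: "F integrable_on {\<alpha>..\<beta>}"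
    using integrable_continuous_real[OF U.B_fun_continuous] by (simp add: F_def)
  have Fa_int: "(\<lambda>s. F s / a s) integrable_on {\<alpha>..\<beta>}"
  proof -
    have "mono_on {\<alpha>..\<beta>} (\<lambda>s. - inverse (a s))"
      using a_pos a_le by (intro mono_onI) (auto intro!: le_imp_inverse_le)
    from integrable_neg[OF integrable_on_mult_mono_on[OF F_int this]] show ?thesis
      by (simp add: divide_inverse)
  qed
  have w_int: "w integrable_on {\<alpha>..\<beta>}"
    unfolding w_def using a_pos a_le \<open>1 < p\<close>
    by (intro integrable_on_mult_mono_on integrable_continuous_real B_fun_continuous mono_onI
        powr_mono2) (auto intro: less_imp_le)
  note sub_int = integrable_subinterval_real[OF F_int] integrable_subinterval_real[OF Fa_int]
    integrable_subinterval_real[OF w_int]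
  have z_cont: "continuous_on {\<alpha>..\<beta>} z"
    unfolding z_def by (intro continuous_intros indefinite_integral_continuous_1 Fa_int)
  have Fa_nonneg: "0 \<le> F s / a s" if "s \<in> {\<alpha>..\<beta>}" for s
    using F_nonneg[OF that] a_pos[OF that] by simp
  have z_diff: "z t - z s = integral {s..t} (\<lambda>s. F s / a s)" if "\<alpha> \<le> s" "s \<le> t" "t \<le> \<beta>" for s t
  proof -
    have "integral {\<alpha>..s} (\<lambda>s. F s / a s) + integral {s..t} (\<lambda>s. F s / a s)
        = integral {\<alpha>..t} (\<lambda>s. F s / a s)"
      using that sub_int(2)[of \<alpha> t] by (intro Henstock_Kurzweil_Integration.integral_combine) auto
    then show ?thesis by (simp add: z_def)
  qed
  have z_mono: "z s \<le> z t" if "\<alpha> \<le> s" "s \<le> t" "t \<le> \<beta>" for s t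
  proof -
    have "0 \<le> integral {s..t} (\<lambda>s. F s / a s)"
      using that Fa_nonneg by (intro integral_nonneg sub_int) auto
    then show ?thesis using z_diff[OF that] by simp
  qed
  have z_start: "z \<alpha> = 1"
    by (simp add: z_def)
  have z_ge1: "1 \<le> z t" if "t \<in> {\<alpha>..\<beta>}" for t
    using z_mono[of \<alpha> t] that z_start by auto
  have u_le: "u t \<le> a t * z t" if t: "t \<in> {\<alpha>..\<beta>}" for t
  proof -
    \<comment> \<open>Monotonicity of \<open>a\<close> lets the divisor \<open>a t\<close> move under the integral sign.\<close>
    have "integral {\<alpha>..t} F / a t = integral {\<alpha>..t} (\<lambda>s. F s / a t)"
      by simp
    also have "\<dots> \<le> integral {\<alpha>..t} (\<lambda>s. F s / a s)"
      using t F_nonneg a_pos a_le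
      by (intro integral_le sub_int integrable_on_divide divide_left_mono mult_pos_pos) auto
    finally have "integral {\<alpha>..t} F \<le> a t * integral {\<alpha>..t} (\<lambda>s. F s / a s)"
      using a_pos[OF t] by (simp add: pos_divide_le_eq mult.commute)
    then show ?thesis
      using ineq[OF t] by (simp add: z_def F_def distrib_left)
  qed
  have Fa_le: "F t / a t \<le> w t * z t powr p" if t: "t \<in> {\<alpha>..\<beta>}" for t
  proof -
    have "u s \<le> a t * z t" if s: "s \<in> {\<alpha>..t}" for s
    proof -
      have "u s \<le> a s * z s"
        using s t by (intro u_le) auto
      also have "\<dots> \<le> a t * z t"
        using s t z_ge1[of s] a_pos[of t] by (intro mult_mono a_le z_mono) auto
      finally show ?thesis .
    qed
    then have "u s powr p \<le> (a t * z t) powr p" if "s \<in> {\<alpha>..t}" for s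
      using that t u_nonneg[of s] \<open>1 < p\<close> by (intro powr_mono2) auto
    then have "F t \<le> B_fun \<alpha> b k h t * (a t * z t) powr p"
      unfolding F_def by (intro B_fun_weighted_le[OF g t])
    also have "\<dots> = w t * z t powr p * a t"
      using a_pos[OF t] z_ge1[OF t] by (simp add: w_def powr_mult powr_diff)
    finally show ?thesis
      using a_pos[OF t] by (simp add: pos_divide_le_eq)
  qed
  have w_nonneg: "0 \<le> w t" if "t \<in> {\<alpha>..\<beta>}" for t
    using B_fun_nonneg[OF that] by (simp add: w_def)
  have "z \<alpha> powr (1 - p) - z T powr (1 - p) \<le> (p - 1) * (\<phi> T - \<phi> \<alpha>)"
  proof (rule bihari_increments[OF \<open>1 < p\<close>])
    fix s t assume st: "\<alpha> \<le> s" "s \<le> t" "t \<le> T"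
    have "z t - z s \<le> integral {s..t} (\<lambda>r. w r * z t powr p)"
    proof (subst z_diff)
      show "integral {s..t} (\<lambda>s. F s / a s) \<le> integral {s..t} (\<lambda>r. w r * z t powr p)"
      proof (rule integral_le)
        fix r assume r: "r \<in> {s..t}"
        have "F r / a r \<le> w r * z r powr p"
          using r st T by (intro Fa_le) auto
        also have "\<dots> \<le> w r * z t powr p"
          using r st T z_ge1[of r] \<open>1 < p\<close> by (intro mult_left_mono powr_mono2 z_mono w_nonneg) auto
        finally show "F r / a r \<le> w r * z t powr p" .
      qed (use st T in \<open>auto intro!: sub_int integrable_on_mult_left\<close>)
    qed (use st T in auto)
    also have "\<dots> = z t powr p * integral {s..t} w"
      by simp
    also have "integral {s..t} w = \<phi> t - \<phi> s"
      using Henstock_Kurzweil_Integration.integral_combine[of \<alpha> s t w] sub_int(3)[of \<alpha> t] st T by (simp add: \<phi>_def)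
    finally show "z t - z s \<le> z t powr p * (\<phi> t - \<phi> s)" .
  next
    show "0 < z t" if "t \<in> {\<alpha>..T}" for t
      using z_ge1[of t] that T by auto
  qed (use T in \<open>auto intro!: z_mono continuous_on_subset[OF z_cont]\<close>)
  then have "1 - (p - 1) * \<phi> T \<le> z T powr (1 - p)"
    using z_start by (simp add: \<phi>_def)
  moreover have pos: "0 < 1 - (p - 1) * \<phi> T"
    using less1 by (simp add: \<phi>_def w_def)
  ultimately have "(z T powr (1 - p)) powr (1 / (1 - p)) \<le> (1 - (p - 1) * \<phi> T) powr (1 / (1 - p))"
    using \<open>1 < p\<close> by (intro powr_mono2') (auto simp: divide_le_0_iff)
  then have "z T \<le> (1 - (p - 1) * \<phi> T) powr (1 / (1 - p))"
    using \<open>1 < p\<close> z_ge1[OF T] by (simp add: powr_powr)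
  then have "a T * z T \<le> a T * (1 - (p - 1) * \<phi> T) powr (1 / (1 - p))"
    using a_pos[OF T] by (intro mult_left_mono) auto
  then show ?thesis
    using u_le[OF T] by (simp add: \<phi>_def w_def)
qed

section \<open>Majorants that may vanish\<close>

text \<open>
  Adding a positive constant to \<open>a\<close> preserves the inequality and monotonicity; dominated
  convergence, with \<open>a + 1\<close> in place of \<open>a\<close> as dominating weight, shows that the bracket in the
  bound depends continuously on that constant, so that it stays positive for large \<open>n\<close>.
\<close>

lemma weighted_B_fun_shift_tendsto:
  fixes a :: "real \<Rightarrow> real"
  assumes "1 < p" and T: "T \<le> \<beta>"
    and a_nonneg: "\<And>t. t \<in> {\<alpha>..\<beta>} \<Longrightarrow> 0 \<le> a t" and a_mono: "mono_on {\<alpha>..\<beta>} a"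
  shows "(\<lambda>n. integral {\<alpha>..T} (\<lambda>s. B_fun \<alpha> b k h s * (a s + inverse (real (Suc n))) powr (p - 1)))
      \<longlonglongrightarrow> integral {\<alpha>..T} (\<lambda>s. B_fun \<alpha> b k h s * a s powr (p - 1))"
proof (rule dominated_convergence(2))
  have int: "(\<lambda>s. B_fun \<alpha> b k h s * (a s + c) powr (p - 1)) integrable_on {\<alpha>..T}" if "0 \<le> c" for c
  proof (rule integrable_on_mult_mono_on)
    show "B_fun \<alpha> b k h integrable_on {\<alpha>..T}"
      using T by (intro integrable_continuous_real continuous_on_subset[OF B_fun_continuous]) auto
    show "mono_on {\<alpha>..T} (\<lambda>s. (a s + c) powr (p - 1))"
      using T a_nonneg \<open>1 < p\<close> that
      by (intro mono_onI powr_mono2) (auto intro!: mono_onD[OF a_mono])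
  qed
  show "(\<lambda>s. B_fun \<alpha> b k h s * (a s + inverse (real (Suc n))) powr (p - 1)) integrable_on {\<alpha>..T}" for n
    by (rule int) simp
  show "(\<lambda>s. B_fun \<alpha> b k h s * (a s + 1) powr (p - 1)) integrable_on {\<alpha>..T}"
    by (rule int) simp
  show "norm (B_fun \<alpha> b k h s * (a s + inverse (real (Suc n))) powr (p - 1))
      \<le> B_fun \<alpha> b k h s * (a s + 1) powr (p - 1)" if s: "s \<in> {\<alpha>..T}" for n s
  proof -
    have "B_fun \<alpha> b k h s * (a s + inverse (real (Suc n))) powr (p - 1)
        \<le> B_fun \<alpha> b k h s * (a s + 1) powr (p - 1)"
      using s T a_nonneg[of s] \<open>1 < p\<close>
      by (intro mult_left_mono powr_mono2 B_fun_nonneg add_left_mono) (auto simp: inverse_le_1_iff)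
    then show ?thesis
      using B_fun_nonneg[of s] s T by (simp add: abs_mult)
  qed
  show "(\<lambda>n. B_fun \<alpha> b k h s * (a s + inverse (real (Suc n))) powr (p - 1))
      \<longlonglongrightarrow> B_fun \<alpha> b k h s * a s powr (p - 1)" if "s \<in> {\<alpha>..T}" for s
  proof -
    have "(\<lambda>n. a s + inverse (real (Suc n))) \<longlonglongrightarrow> a s + 0"
      by (intro tendsto_intros LIMSEQ_inverse_real_of_nat)
    then show ?thesis
      using \<open>1 < p\<close> a_nonneg[of s] that T
      by (intro tendsto_mult tendsto_const tendsto_powr') auto
  qed
qed

lemma bound_of_nonneg_majorant:
  fixes u a :: "real \<Rightarrow> real"
  assumes "1 < p" and T: "T \<in> {\<alpha>..\<beta>}"
    and u_cont: "continuous_on {\<alpha>..\<beta>} u" and u_nonneg: "\<And>t. t \<in> {\<alpha>..\<beta>} \<Longrightarrow> 0 \<le> u t"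
    and a_nonneg: "\<And>t. t \<in> {\<alpha>..\<beta>} \<Longrightarrow> 0 \<le> a t" and a_mono: "mono_on {\<alpha>..\<beta>} a"
    and ineq: "\<And>t. t \<in> {\<alpha>..\<beta>} \<Longrightarrow> u t \<le> a t + integral {\<alpha>..t}
        (B_fun \<alpha> (\<lambda>t. b t * u t powr p) (\<lambda>t s. k t s * u s powr p) (\<lambda>t s \<tau>. h t s \<tau> * u \<tau> powr p))"
    and less1: "(p - 1) * integral {\<alpha>..T} (\<lambda>s. B_fun \<alpha> b k h s * a s powr (p - 1)) < 1"
  shows "u T \<le> a T * (1 - (p - 1) * integral {\<alpha>..T} (\<lambda>s. B_fun \<alpha> b k h s * a s powr (p - 1)))
      powr (1 / (1 - p))"
proof -
  define e where "e = (\<lambda>n. inverse (real (Suc n)))"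
  define I where "I = (\<lambda>n. integral {\<alpha>..T} (\<lambda>s. B_fun \<alpha> b k h s * (a s + e n) powr (p - 1)))"
  define L where "L = integral {\<alpha>..T} (\<lambda>s. B_fun \<alpha> b k h s * a s powr (p - 1))"
  have e: "e \<longlonglongrightarrow> 0" "0 < e n" for n
    using LIMSEQ_inverse_real_of_nat by (simp_all add: e_def)
  have I: "I \<longlonglongrightarrow> L"
    unfolding I_def L_def e_def using T a_nonneg a_mono \<open>1 < p\<close>
    by (intro weighted_B_fun_shift_tendsto) auto
  have "(\<lambda>n. (p - 1) * I n) \<longlonglongrightarrow> (p - 1) * L"
    by (intro tendsto_intros I)
  then have "eventually (\<lambda>n. (p - 1) * I n < 1) sequentially"
    using less1 by (intro order_tendstoD(2)) (auto simp: L_def)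
  then have "eventually (\<lambda>n. u T \<le> (a T + e n) * (1 - (p - 1) * I n) powr (1 / (1 - p))) sequentially"
  proof eventually_elim
    case (elim n)
    show ?case
      unfolding I_def
    proof (rule bound_of_positive_majorant[OF \<open>1 < p\<close> T u_cont u_nonneg])
      show "0 < a t + e n" if "t \<in> {\<alpha>..\<beta>}" for t
        using a_nonneg[OF that] e(2)[of n] by simp
      show "mono_on {\<alpha>..\<beta>} (\<lambda>t. a t + e n)"
        using a_mono by (auto simp: mono_on_def)
      show "u t \<le> a t + e n + integral {\<alpha>..t}
        (B_fun \<alpha> (\<lambda>t. b t * u t powr p) (\<lambda>t s. k t s * u s powr p) (\<lambda>t s \<tau>. h t s \<tau> * u \<tau> powr p))"
        if "t \<in> {\<alpha>..\<beta>}" for t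
        using ineq[OF that] e(2)[of n] by simp
    qed (use elim in \<open>simp_all add: I_def\<close>)
  qed
  moreover have "(\<lambda>n. (a T + e n) * (1 - (p - 1) * I n) powr (1 / (1 - p)))
      \<longlonglongrightarrow> (a T + 0) * (1 - (p - 1) * L) powr (1 / (1 - p))"
    using less1 by (intro tendsto_intros I e) (auto simp: L_def)
  ultimately show ?thesis
    using tendsto_lowerbound by (fastforce simp: L_def)
qed

text \<open>
  Since \<open>t \<mapsto> \<integral> B a\<^sup>p\<^sup>-\<^sup>1\<close> is nondecreasing, the set in \<open>beta_p\<close> is an interval starting
  at \<open>\<alpha>\<close>; so every point between \<open>\<alpha>\<close> and its supremum belongs to it.
\<close>

lemma less_one_of_less_beta_p:
  assumes "1 < p" "\<alpha> \<le> \<beta>"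
    and a_nonneg: "\<And>t. t \<in> {\<alpha>..\<beta>} \<Longrightarrow> 0 \<le> a t" and a_mono: "mono_on {\<alpha>..\<beta>} a"
    and t: "\<alpha> \<le> t" "t < beta_p \<alpha> \<beta> p a b k h"
  shows "t \<le> \<beta>" and "(p - 1) * integral {\<alpha>..t} (\<lambda>s. B_fun \<alpha> b k h s * a s powr (p - 1)) < 1"
proof -
  let ?w = "\<lambda>s. B_fun \<alpha> b k h s * a s powr (p - 1)"
  let ?S = "{t \<in> {\<alpha>..\<beta>}. (p - 1) * integral {\<alpha>..t} ?w < 1}"
  have "\<alpha> \<in> ?S"
    using \<open>\<alpha> \<le> \<beta>\<close> by simp
  moreover have "bdd_above ?S"
    by (rule bdd_above_mono[of "{\<alpha>..\<beta>}"]) auto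
  ultimately obtain t' where t': "t' \<in> ?S" "t < t'"
    using t(2) less_cSup_iff[of ?S t] unfolding beta_p_def by blast
  then show "t \<le> \<beta>"
    by auto
  have w_int: "?w integrable_on {\<alpha>..\<beta>}"
    using a_nonneg \<open>1 < p\<close>
    by (intro integrable_on_mult_mono_on integrable_continuous_real B_fun_continuous mono_onI
        powr_mono2) (auto intro!: mono_onD[OF a_mono])
  have "integral {\<alpha>..t} ?w \<le> integral {\<alpha>..t'} ?w"
    using t' t(1) B_fun_nonneg
    by (intro integral_subset_le integrable_subinterval_real[OF w_int]) auto
  then have "(p - 1) * integral {\<alpha>..t} ?w \<le> (p - 1) * integral {\<alpha>..t'} ?w"
    using \<open>1 < p\<close> by (intro mult_left_mono) auto
  then show "(p - 1) * integral {\<alpha>..t} ?w < 1"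
    using t'(1) by auto
qed

end

theorem theorem2p2:
  fixes \<alpha> \<beta> p :: real
    and u a b :: "real \<Rightarrow> real"
    and k :: "real \<Rightarrow> real \<Rightarrow> real"
    and h :: "real \<Rightarrow> real \<Rightarrow> real \<Rightarrow> real"
  assumes "\<alpha> < \<beta>"
    and "p > 1"
    and "continuous_on {\<alpha>..\<beta>} u"
    and "continuous_on {\<alpha>..\<beta>} b"
    and "continuous_on {(t, s). \<alpha> \<le> s \<and> s \<le> t \<and> t \<le> \<beta>} (\<lambda>(t, s). k t s)"
    and "continuous_on {(t, s, \<tau>). \<alpha> \<le> \<tau> \<and> \<tau> \<le> s \<and> s \<le> t \<and> t \<le> \<beta>} (\<lambda>(t, s, \<tau>). h t s \<tau>)"
    and "\<And>t. t \<in> {\<alpha>..\<beta>} \<Longrightarrow> u t \<ge> 0"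
    and "\<And>t. t \<in> {\<alpha>..\<beta>} \<Longrightarrow> b t \<ge> 0"
    and "\<And>t s. \<alpha> \<le> s \<Longrightarrow> s \<le> t \<Longrightarrow> t \<le> \<beta> \<Longrightarrow> k t s \<ge> 0"
    and "\<And>t s \<tau>. \<alpha> \<le> \<tau> \<Longrightarrow> \<tau> \<le> s \<Longrightarrow> s \<le> t \<Longrightarrow> t \<le> \<beta> \<Longrightarrow> h t s \<tau> \<ge> 0"
    and "\<And>t. t \<in> {\<alpha>..\<beta>} \<Longrightarrow> a t \<ge> 0"
    and "mono_on {\<alpha>..\<beta>} a"
    and "\<And>t. t \<in> {\<alpha>..\<beta>} \<Longrightarrow>
          u t \<le> a t
            + integral {\<alpha>..t} (\<lambda>s. b s * u s powr p)
            + integral {\<alpha>..t} (\<lambda>s. integral {\<alpha>..s} (\<lambda>\<tau>. k s \<tau> * u \<tau> powr p))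
            + integral {\<alpha>..t} (\<lambda>s. integral {\<alpha>..s} (\<lambda>\<tau>. integral {\<alpha>..\<tau>} (\<lambda>\<sigma>. h s \<tau> \<sigma> * u \<sigma> powr p)))"
  shows "\<forall>t \<in> {\<alpha>..<beta_p \<alpha> \<beta> p a b k h}.
          u t \<le> a t * (1 - (p - 1) * integral {\<alpha>..t} (\<lambda>s. B_fun \<alpha> b k h s * a s powr (p - 1))) powr (1 / (1 - p))"
proof
  fix t assume t: "t \<in> {\<alpha>..<beta_p \<alpha> \<beta> p a b k h}"
  interpret volterra_kernels \<alpha> \<beta> b k h
    by standard (use assms in auto)
  have g: "continuous_on {\<alpha>..\<beta>} (\<lambda>t. u t powr p)" "\<And>t. t \<in> {\<alpha>..\<beta>} \<Longrightarrow> 0 \<le> u t powr p"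
    using assms(2,3,7) by (auto intro!: continuous_on_powr')
  interpret U: volterra_kernels \<alpha> \<beta> "\<lambda>t. b t * u t powr p" "\<lambda>t s. k t s * u s powr p"
      "\<lambda>t s \<tau>. h t s \<tau> * u \<tau> powr p"
    by (rule volterra_kernels_weighted[OF g])
  have ineq: "u t \<le> a t + integral {\<alpha>..t}
        (B_fun \<alpha> (\<lambda>t. b t * u t powr p) (\<lambda>t s. k t s * u s powr p) (\<lambda>t s \<tau>. h t s \<tau> * u \<tau> powr p))"
    if "t \<in> {\<alpha>..\<beta>}" for t
    using assms(13)[OF that] U.integral_B_fun[of t] that by simp
  have "\<alpha> \<le> \<beta>" and "\<alpha> \<le> t" and "t < beta_p \<alpha> \<beta> p a b k h"
    using assms(1) t by auto
  note * = less_one_of_less_beta_p[OF \<open>p > 1\<close> \<open>\<alpha> \<le> \<beta>\<close> assms(11,12) this(2,3)]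
  have "t \<in> {\<alpha>..\<beta>}"
    using *(1) \<open>\<alpha> \<le> t\<close> by simp
  then show "u t \<le> a t * (1 - (p - 1) * integral {\<alpha>..t} (\<lambda>s. B_fun \<alpha> b k h s * a s powr (p - 1))) powr (1 / (1 - p))"
    by (rule bound_of_nonneg_majorant[OF \<open>p > 1\<close> _ assms(3,7,11,12) ineq *(2)])
qed

end
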